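(* If $T\subseteq\mathbb{Z}^n$ is an integer tiling with $\Upsilon_n$, where $n$ is even, then $n=3^t-1$ for some $t>0$.
   Context: $\Upsilon_n=\{U\in\mathbb{Z}^n:\sum_i|x_i-u_i|\le1\text{ for some }X\in\{-1,0\}^n\}$. A set $T\subseteq\mathbb{Z}^n$ is an integer tiling with $\Upsilon_n$ if the translates $X+\Upsilon_n$, $X\in T$, partition $\mathbb{Z}^n$. *)

theory Defs
  imports "HOL-Analysis.Finite_Cartesian_Product" "HOL-Library.Disjoint_Sets"
begin

(* The dimension n is CARD('n), which is positive since types are nonempty. *)

definition upsilon :: "(int ^ 'n) set" where
  "upsilon = {u. \<exists>x. (\<forall>i. x $ i \<in> {-1, 0}) \<and> (\<Sum>i\<in>UNIV. \<bar>x $ i - u $ i\<bar>) \<le> 1}"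

(* Disjointness is required of the family indexed by T, so translates by distinct elements of T
   are disjoint. *)
definition integer_tiling :: "(int ^ 'n) set \<Rightarrow> (int ^ 'n) set \<Rightarrow> bool" where
  "integer_tiling V T \<longleftrightarrow>
     disjoint_family_on (\<lambda>x. (+) x ` V) T \<and> (\<Union>x\<in>T. (+) x ` V) = UNIV"

end

theory Submission
  imports Defs "HOL-Computational_Algebra.Primes"
begin

text \<open>
  The set \<open>upsilon\<close> consists of the points at \<open>\<ell>\<^sub>1\<close>-distance at most 1 from the cube
  \<open>{-1, 0}\<^sup>n\<close>. Hence in a tiling \<open>T\<close> any two of the cubes \<open>x + {-1, 0}\<^sup>n\<close> with \<open>x \<in> T\<close> are at
  distance at least 3, while every point is within distance 1 of some cube.

  Looking at the points at distance 2 beyond a face of the cube of \<open>x \<in> T\<close> in direction \<open>i\<close>, one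
  finds that either \<open>x + 4e\<^sub>i \<in> T\<close> or \<open>x + 3e\<^sub>i \<plusminus> 2e\<^sub>j \<in> T\<close> for some \<open>j\<close>. In the first case consider,
  for each \<open>j \<noteq> i\<close>, the point \<open>x + 2e\<^sub>i + e\<^sub>j\<close> in the gap between the cubes of \<open>x\<close> and \<open>x + 4e\<^sub>i\<close>. It is
  covered either by \<open>x + 2e\<^sub>i + 3e\<^sub>j\<close> or by a point of \<open>T\<close> that covers exactly one further such point
  \<open>x + 2e\<^sub>i + e\<^sub>k\<close>. The latter kind pairs up the directions, and there are \<open>n - 1\<close>, an odd number, of
  them, so \<open>x + 2e\<^sub>i + 3e\<^sub>j \<in> T\<close> for some \<open>j\<close>; this \<open>j\<close> is unique and \<open>x + 2e\<^sub>i - 3e\<^sub>j \<in> T\<close> as well.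

  Combining these facts, \<open>x \<in> T\<close> implies that \<open>x + 4e\<^sub>i\<close> or \<open>x + 6e\<^sub>i\<close> is in \<open>T\<close>, and the step that
  is taken repeats, so \<open>T\<close> has period 12 in every direction. Counting modulo 12 shows that
  \<open>card upsilon = 2\<^sup>n(n + 1)\<close> divides \<open>12\<^sup>n\<close>. As \<open>n + 1\<close> is odd, it is a power of 3.
\<close>

section \<open>Counting in periodic tilings\<close>

text \<open>An integer vector whose absolute values sum to at most 1 has at most one nonzero entry,
  so at most one coordinate \<open>m\<close> leaves the range of the cube, and only by 1. All later
  arguments use this coordinatewise form.\<close>

lemma mem_upsilon_iff:
  "u \<in> upsilon \<longleftrightarrow> (\<exists>m. -2 \<le> u $ m \<and> u $ m \<le> 1 \<and> (\<forall>l. l \<noteq> m \<longrightarrow> -1 \<le> u $ l \<and> u $ l \<le> 0))"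
proof
  assume "u \<in> upsilon"
  then obtain x where x: "\<And>l. x $ l \<in> {-1, 0}" and le: "(\<Sum>l\<in>UNIV. \<bar>x $ l - u $ l\<bar>) \<le> 1"
    by (auto simp: upsilon_def)
  obtain m where m: "\<And>l. l \<noteq> m \<Longrightarrow> x $ l = u $ l"
  proof (cases "x = u")
    case False
    then obtain m where "x $ m \<noteq> u $ m"
      by (auto simp: vec_eq_iff)
    moreover have "\<bar>x $ m - u $ m\<bar> + \<bar>x $ l - u $ l\<bar> \<le> 1" if "l \<noteq> m" for l
    proof -
      have "(\<Sum>k\<in>{m, l}. \<bar>x $ k - u $ k\<bar>) \<le> (\<Sum>k\<in>UNIV. \<bar>x $ k - u $ k\<bar>)"
        by (rule sum_mono2) auto
      with le that show ?thesis by simp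
    qed
    ultimately have "x $ l = u $ l" if "l \<noteq> m" for l
      using that by fastforce
    then show ?thesis using that by blast
  qed (use that in auto)
  have "\<bar>x $ m - u $ m\<bar> \<le> (\<Sum>l\<in>UNIV. \<bar>x $ l - u $ l\<bar>)"
    by (rule member_le_sum) auto
  then have "-2 \<le> u $ m" "u $ m \<le> 1"
    using le x[of m] by auto
  moreover have "-1 \<le> u $ l \<and> u $ l \<le> 0" if "l \<noteq> m" for l
    using m[OF that] x[of l] by auto
  ultimately show "\<exists>m. -2 \<le> u $ m \<and> u $ m \<le> 1 \<and> (\<forall>l. l \<noteq> m \<longrightarrow> -1 \<le> u $ l \<and> u $ l \<le> 0)"
    by blast
next
  assume "\<exists>m. -2 \<le> u $ m \<and> u $ m \<le> 1 \<and> (\<forall>l. l \<noteq> m \<longrightarrow> -1 \<le> u $ l \<and> u $ l \<le> 0)"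
  then obtain m where m: "-2 \<le> u $ m" "u $ m \<le> 1" "\<And>l. l \<noteq> m \<Longrightarrow> -1 \<le> u $ l \<and> u $ l \<le> 0"
    by blast
  define x :: "int ^ 'a" where "x = (\<chi> l. max (-1) (min 0 (u $ l)))"
  have "(\<Sum>l\<in>UNIV. \<bar>x $ l - u $ l\<bar>) = \<bar>x $ m - u $ m\<bar> + (\<Sum>l\<in>UNIV - {m}. \<bar>x $ l - u $ l\<bar>)"
    by (simp add: sum.remove)
  also have "(\<Sum>l\<in>UNIV - {m}. \<bar>x $ l - u $ l\<bar>) = 0"
    using m(3) by (intro sum.neutral) (auto simp: x_def)
  also have "\<bar>x $ m - u $ m\<bar> + 0 \<le> 1"
    using m(1,2) by (auto simp: x_def)
  finally show "u \<in> upsilon"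
    unfolding upsilon_def by (intro CollectI exI[of _ x] conjI) (auto simp: x_def)
qed

text \<open>A point of \<open>upsilon\<close> amounts to a vertex \<open>a\<close> of the cube,
  recovered by clamping, and either no direction or one direction in which the vertex is pushed
  outwards by 1. The element of \<open>'n option\<close> records the direction and yields the factor
  \<open>CARD('n) + 1\<close>.\<close>

lemma CARD_Suc_dvd_card_upsilon: "(CARD('n) + 1) dvd card (upsilon :: (int ^ 'n) set)"
proof -
  define Q :: "(int ^ 'n) set" where "Q = {a. \<forall>l. a $ l \<in> {-1, 0}}"
  define h :: "(int ^ 'n) \<times> 'n option \<Rightarrow> int ^ 'n" where
    "h = (\<lambda>(a, s). \<chi> l. if s = Some l then (if a $ l = 0 then 1 else -2) else a $ l)"
  have "h ` (Q \<times> UNIV) = upsilon"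
  proof (intro equalityI subsetI)
    fix u assume "u \<in> h ` (Q \<times> UNIV)"
    then obtain a s where u: "u = h (a, s)" and a: "\<And>l. a $ l = -1 \<or> a $ l = 0"
      by (auto simp: Q_def)
    show "u \<in> upsilon"
      unfolding mem_upsilon_iff
    proof (intro exI conjI allI impI)
      \<comment> \<open>For \<open>None\<close> any coordinate may serve as the exceptional one,
        since all of them lie between -1 and 0.\<close>
      let ?m = "case s of Some m \<Rightarrow> m | None \<Rightarrow> undefined"
      show "-2 \<le> u $ ?m" "u $ ?m \<le> 1"
        using a[of ?m] by (auto simp: u h_def)
      show "-1 \<le> u $ l" "u $ l \<le> 0" if "l \<noteq> ?m" for l
        using a[of l] that by (auto simp: u h_def)
    qed
  next
    fix u :: "int ^ 'n" assume "u \<in> upsilon"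
    then obtain m where m: "-2 \<le> u $ m" "u $ m \<le> 1"
      and l: "\<And>l. l \<noteq> m \<Longrightarrow> -1 \<le> u $ l \<and> u $ l \<le> 0"
      unfolding mem_upsilon_iff by blast
    define a :: "int ^ 'n" where "a = (\<chi> l. max (-1) (min 0 (u $ l)))"
    have "a \<in> Q"
      by (auto simp: Q_def a_def)
    moreover have "u = h (a, if u $ m \<in> {-1, 0} then None else Some m)"
    proof (rule vec_eq_iff[THEN iffD2], rule allI)
      show "u $ k = h (a, if u $ m \<in> {-1, 0} then None else Some m) $ k" for k
        using m l[of k] by (cases "k = m") (auto simp: h_def a_def)
    qed
    ultimately show "u \<in> h ` (Q \<times> UNIV)"
      by (intro image_eqI[of _ h]) auto
  qed
  moreover have "inj_on h (Q \<times> UNIV)"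
  proof (rule inj_onI)
    fix p q assume pq: "p \<in> Q \<times> UNIV" "q \<in> Q \<times> UNIV" "h p = h q"
    obtain a s b t where p: "p = (a, s)" and q: "q = (b, t)"
      by (metis surj_pair)
    have "h (a, s) $ l = h (b, t) $ l" for l
      using pq(3) p q by simp
    then have eq: "(if s = Some l then (if a $ l = 0 then 1 else -2) else a $ l) =
        (if t = Some l then (if b $ l = 0 then 1 else -2) else b $ l)" for l
      unfolding h_def by simp
    have Q: "(a $ l = -1 \<or> a $ l = 0) \<and> (b $ l = -1 \<or> b $ l = 0)" for l
      using pq p q by (simp add: Q_def)
    have st: "s = Some l \<longleftrightarrow> t = Some l" and ab: "a $ l = b $ l" for l
      using eq[of l] Q[of l] by (smt (verit))+
    have "s = t"
      using st by (metis not_Some_eq)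
    with ab show "p = q"
      by (simp add: p q vec_eq_iff)
  qed
  ultimately have "card (upsilon :: (int ^ 'n) set) = card Q * card (UNIV :: 'n option set)"
    by (metis card_cartesian_product card_image)
  then show ?thesis
    by (simp add: card_UNIV_option del: mult_Suc_right)
qed

section \<open>Tilings with a period in every coordinate\<close>

lemma card_box: "card {x :: int ^ 'n. \<forall>l. 0 \<le> x $ l \<and> x $ l < int m} = m ^ CARD('n)"
proof -
  have "bij_betw vec_lambda (PiE UNIV (\<lambda>_. {0..<int m})) {x :: int ^ 'n. \<forall>l. 0 \<le> x $ l \<and> x $ l < int m}"
    by (rule bij_betwI[of _ _ _ vec_nth]) (auto simp: PiE_def Pi_def)
  then have "card {x :: int ^ 'n. \<forall>l. 0 \<le> x $ l \<and> x $ l < int m} = card (PiE (UNIV :: 'n set) (\<lambda>_. {0..<int m}))"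
    by (simp add: bij_betw_same_card)
  then show ?thesis
    by (simp add: card_PiE)
qed

text \<open>The translations in \<open>per\<close> only go forward, hence the sign condition on
  \<open>k\<close>. The shift is assembled one coordinate at a time.\<close>

lemma add_multiples_mem:
  fixes T :: "(int ^ 'n) set"
  assumes per: "\<And>x i. x \<in> T \<Longrightarrow> x + axis i m \<in> T" and "x \<in> T" and k: "\<And>l. 0 \<le> k l"
  shows "x + (\<chi> l. m * k l) \<in> T"
proof -
  have step: "y + axis i (m * int c) \<in> T" if "y \<in> T" for y i c
  proof (induction c)
    case (Suc c)
    have eq: "y + axis i (m * int (Suc c)) = y + axis i (m * int c) + axis i m"
      by (auto simp: vec_eq_iff axis_def algebra_simps)
    show ?case
      unfolding eq by (rule per[OF Suc])
  qed (use that in \<open>simp add: axis_def flip: zero_vec_def\<close>)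
  have "x + (\<Sum>l\<in>F. axis l (m * k l)) \<in> T" for F :: "'n set"
  proof (induction F rule: infinite_finite_induct)
    case (insert l F)
    then show ?case
      using step[OF insert.IH, of l "nat (k l)"] k[of l] by (simp add: ac_simps)
  qed (use \<open>x \<in> T\<close> in auto)
  moreover have "(\<Sum>l\<in>UNIV. axis l (m * k l)) = (\<chi> l. m * k l)"
    by (simp add: vec_eq_iff axis_def)
  ultimately show ?thesis
    by metis
qed

text \<open>Modulo \<open>m\<close>, the residues of \<open>T\<close> together with \<open>V\<close>
  represent every point of the box of side \<open>m\<close> exactly once, so \<open>card V\<close>
  times the number of residues is \<open>m ^ CARD('n)\<close>.\<close>

lemma card_dvd_of_periodic_tiling:
  fixes T V :: "(int ^ 'n) set"
  assumes tiling: "integer_tiling V T" and "m > 0"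
    and per: "\<And>x i. x \<in> T \<Longrightarrow> x + axis i (int m) \<in> T"
  shows "card V dvd m ^ CARD('n)"
proof -
  define red :: "int ^ 'n \<Rightarrow> int ^ 'n" where "red x = (\<chi> l. x $ l mod int m)" for x
  define f where "f = (\<lambda>(r, u). red (r + u))"
  have red_add: "red (red x + u) = red (x + u)" for x u
    by (simp add: red_def vec_eq_iff mod_add_left_eq)
  have disj: "x = y \<and> u = v" if "x \<in> T" "y \<in> T" "u \<in> V" "v \<in> V" "x + u = y + v" for x y u v
    using tiling that unfolding integer_tiling_def disjoint_family_on_def
    by (metis (no_types, lifting) add_left_cancel disjoint_iff image_eqI)
  have "inj_on f (red ` T \<times> V)"
  proof (rule inj_onI, clarsimp simp: f_def red_add)
    fix x y u v
    assume mem: "x \<in> T" "y \<in> T" "u \<in> V" "v \<in> V" and eq: "red (x + u) = red (y + v)"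
    define q where "q l = ((y + v) $ l - (x + u) $ l) div int m" for l
    have q: "int m * q l = (y + v) $ l - (x + u) $ l" for l
    proof -
      have "((x + u) $ l) mod int m = ((y + v) $ l) mod int m"
        using eq unfolding red_def vec_eq_iff by simp
      then have "int m dvd (y + v) $ l - (x + u) $ l"
        by (metis mod_eq_dvd_iff)
      then show ?thesis by (simp add: q_def)
    qed
    \<comment> \<open>As only forward shifts are available, the positive part of \<open>q\<close> is
      applied to \<open>x\<close> and the negative part to \<open>y\<close>.\<close>
    define x' where "x' = x + (\<chi> l. int m * max (q l) 0)"
    define y' where "y' = y + (\<chi> l. int m * max (- q l) 0)"
    have "x' \<in> T" "y' \<in> T"
      unfolding x'_def y'_def using add_multiples_mem[OF per] mem by auto
    moreover have "x' + u = y' + v"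
    proof -
      have "int m * max (q l) 0 = int m * max (- q l) 0 + int m * q l" for l
        by (auto simp: max_def)
      then show ?thesis
        using q by (simp add: x'_def y'_def vec_eq_iff)
    qed
    ultimately have "x' = y'" "u = v"
      using disj mem by auto
    moreover have "red x' = red x" "red y' = red y"
      by (simp_all add: red_def x'_def y'_def vec_eq_iff)
    ultimately show "red x = red y \<and> u = v"
      by simp
  qed
  moreover have "f ` (red ` T \<times> V) = {x. \<forall>l. 0 \<le> x $ l \<and> x $ l < int m}"
  proof (intro equalityI subsetI)
    fix z :: "int ^ 'n" assume z: "z \<in> {x. \<forall>l. 0 \<le> x $ l \<and> x $ l < int m}"
    obtain x u where "x \<in> T" "u \<in> V" "z = x + u"
      using tiling unfolding integer_tiling_def by blast
    moreover have "red z = z"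
      using z by (simp add: red_def vec_eq_iff)
    ultimately show "z \<in> f ` (red ` T \<times> V)"
      by (intro image_eqI[of _ _ "(red x, u)"]) (auto simp: f_def red_add)
  qed (use \<open>m > 0\<close> in \<open>auto simp: f_def red_def\<close>)
  ultimately have "card (red ` T \<times> V) = card {x :: int ^ 'n. \<forall>l. 0 \<le> x $ l \<and> x $ l < int m}"
    using card_image by fastforce
  then have "card (red ` T) * card V = m ^ CARD('n)"
    unfolding card_box card_cartesian_product .
  then show ?thesis
    by (metis dvd_triv_right)
qed

section \<open>The local structure of a tiling\<close>

definition reflect :: "'n \<Rightarrow> int ^ 'n \<Rightarrow> int ^ 'n" where
  "reflect k x = (\<chi> l. if l = k then - x $ l else x $ l)"

lemma reflect_nth [simp]: "reflect k x $ l = (if l = k then - x $ l else x $ l)"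
  by (simp add: reflect_def)

lemma reflect_reflect [simp]: "reflect k (reflect k x) = x"
  by (simp add: vec_eq_iff)

lemma axis_nth_if: "axis i c $ j = (if j = i then c else 0)"
  by (simp add: axis_def)

lemma reflect_zero [simp]: "reflect k 0 = 0"
  by (simp add: vec_eq_iff)

lemma reflect_add: "reflect k (x + y) = reflect k x + reflect k y"
  by (simp add: vec_eq_iff)

lemma reflect_axis: "reflect k (axis i c) = axis i (if i = k then - c else c)"
  by (simp add: vec_eq_iff axis_nth_if)

text \<open>The premises of \<open>pack2\<close> and \<open>pack3\<close> list the ways in which two cubes can be at distance
  at most 2.\<close>

locale half_cross_tiling =
  fixes T :: "(int ^ 'n) set"
  assumes cover: "\<exists>x\<in>T. \<exists>m. -2 \<le> z $ m - x $ m \<and> z $ m - x $ m \<le> 1 \<and>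
      (\<forall>l. l \<noteq> m \<longrightarrow> -1 \<le> z $ l - x $ l \<and> z $ l - x $ l \<le> 0)"
    and pack2: "\<lbrakk>x \<in> T; y \<in> T; \<bar>x $ i - y $ i\<bar> \<le> 2; \<bar>x $ j - y $ j\<bar> \<le> 2;
      \<And>l. \<lbrakk>l \<noteq> i; l \<noteq> j\<rbrakk> \<Longrightarrow> \<bar>x $ l - y $ l\<bar> \<le> 1\<rbrakk> \<Longrightarrow> x = y"
    and pack3: "\<lbrakk>x \<in> T; y \<in> T; \<bar>x $ i - y $ i\<bar> \<le> 3;
      \<And>l. l \<noteq> i \<Longrightarrow> \<bar>x $ l - y $ l\<bar> \<le> 1\<rbrakk> \<Longrightarrow> x = y"
begin

text \<open>With this and \<open>reflection\<close>, local facts need only be proved at the base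
  point 0 and on one side of its cube.\<close>

lemma translate: "half_cross_tiling {x. v + x \<in> T}"
proof
  fix z
  obtain x m where "x \<in> T" and "-2 \<le> (v + z) $ m - x $ m \<and> (v + z) $ m - x $ m \<le> 1 \<and>
      (\<forall>l. l \<noteq> m \<longrightarrow> -1 \<le> (v + z) $ l - x $ l \<and> (v + z) $ l - x $ l \<le> 0)"
    using cover by blast
  then show "\<exists>x\<in>{x. v + x \<in> T}. \<exists>m. -2 \<le> z $ m - x $ m \<and> z $ m - x $ m \<le> 1 \<and>
      (\<forall>l. l \<noteq> m \<longrightarrow> -1 \<le> z $ l - x $ l \<and> z $ l - x $ l \<le> 0)"
    by (intro bexI[of _ "x - v"] exI[of _ m]) (auto simp: algebra_simps)
next
  fix x y i j
  assume "x \<in> {x. v + x \<in> T}" "y \<in> {x. v + x \<in> T}" "\<bar>x $ i - y $ i\<bar> \<le> 2" "\<bar>x $ j - y $ j\<bar> \<le> 2"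
    and "\<And>l. \<lbrakk>l \<noteq> i; l \<noteq> j\<rbrakk> \<Longrightarrow> \<bar>x $ l - y $ l\<bar> \<le> 1"
  then show "x = y"
    using pack2[of "v + x" "v + y" i j] by simp
next
  fix x y i
  assume "x \<in> {x. v + x \<in> T}" "y \<in> {x. v + x \<in> T}" "\<bar>x $ i - y $ i\<bar> \<le> 3"
    and "\<And>l. l \<noteq> i \<Longrightarrow> \<bar>x $ l - y $ l\<bar> \<le> 1"
  then show "x = y"
    using pack3[of "v + x" "v + y" i] by simp
qed

text \<open>Reflecting \<open>T\<close> in \<open>0\<close> corresponds to reflecting the covered points in \<open>-1/2\<close>, which
  is the centre of the cube \<open>{-1, 0}\<close>.\<close>

lemma reflection: "half_cross_tiling {x. reflect k x \<in> T}"
proof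
  fix z :: "int ^ 'n"
  define z' where "z' = (\<chi> l. if l = k then -1 - z $ l else z $ l)"
  obtain x m where "x \<in> T" and "-2 \<le> z' $ m - x $ m \<and> z' $ m - x $ m \<le> 1 \<and>
      (\<forall>l. l \<noteq> m \<longrightarrow> -1 \<le> z' $ l - x $ l \<and> z' $ l - x $ l \<le> 0)"
    using cover by blast
  then show "\<exists>x\<in>{x. reflect k x \<in> T}. \<exists>m. -2 \<le> z $ m - x $ m \<and> z $ m - x $ m \<le> 1 \<and>
      (\<forall>l. l \<noteq> m \<longrightarrow> -1 \<le> z $ l - x $ l \<and> z $ l - x $ l \<le> 0)"
    by (intro bexI[of _ "reflect k x"] exI[of _ m]) (fastforce simp: z'_def split: if_splits)+
next
  fix x y i j
  assume *: "x \<in> {x. reflect k x \<in> T}" "y \<in> {x. reflect k x \<in> T}"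
      "\<bar>x $ i - y $ i\<bar> \<le> 2" "\<bar>x $ j - y $ j\<bar> \<le> 2"
      "\<And>l. \<lbrakk>l \<noteq> i; l \<noteq> j\<rbrakk> \<Longrightarrow> \<bar>x $ l - y $ l\<bar> \<le> 1"
  have "reflect k x = reflect k y"
    by (rule pack2[of _ _ i j]) (use * in \<open>auto simp: abs_minus_commute\<close>)
  then show "x = y"
    by (metis reflect_reflect)
next
  fix x y i
  assume *: "x \<in> {x. reflect k x \<in> T}" "y \<in> {x. reflect k x \<in> T}" "\<bar>x $ i - y $ i\<bar> \<le> 3"
      "\<And>l. l \<noteq> i \<Longrightarrow> \<bar>x $ l - y $ l\<bar> \<le> 1"
  have "reflect k x = reflect k y"
    by (rule pack3[of _ _ i]) (use * in \<open>auto simp: abs_minus_commute\<close>)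
  then show "x = y"
    by (metis reflect_reflect)
qed

section \<open>Neighbours beyond a face\<close>

lemma obtain_cover:
  obtains x m where "x \<in> T" "-2 \<le> z $ m - x $ m" "z $ m - x $ m \<le> 1"
    "\<forall>l. l \<noteq> m \<longrightarrow> -1 \<le> z $ l - x $ l \<and> z $ l - x $ l \<le> 0"
  using cover[of z] by auto

text \<open>The point \<open>axis i 2\<close> is at distance 2 from the cube of 0. Packing against 0
  leaves only the extreme positions for the point of \<open>T\<close> that covers it.\<close>

lemma beyond_face:
  assumes "0 \<in> T"
  obtains x where "x \<in> T" "x $ i = 4" "\<And>l. l \<noteq> i \<Longrightarrow> 0 \<le> x $ l \<and> x $ l \<le> 1"
  | x j where "x \<in> T" "j \<noteq> i" "x $ i = 3" "x $ j = 2" "\<And>l. \<lbrakk>l \<noteq> i; l \<noteq> j\<rbrakk> \<Longrightarrow> 0 \<le> x $ l \<and> x $ l \<le> 1"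
proof -
  obtain x m where x: "x \<in> T" "-2 \<le> axis i 2 $ m - x $ m" "axis i 2 $ m - x $ m \<le> 1"
    "\<forall>l. l \<noteq> m \<longrightarrow> -1 \<le> axis i 2 $ l - x $ l \<and> axis i 2 $ l - x $ l \<le> 0"
    by (rule obtain_cover[of "axis i 2"])
  have *: "0 \<le> x $ l \<and> x $ l \<le> 1" if "l \<noteq> m" "l \<noteq> i" for l
    using spec[OF x(4), of l] that by (auto simp: axis_nth_if)
  show ?thesis
  proof (cases "m = i")
    case True
    then have b: "1 \<le> x $ i" "x $ i \<le> 4"
      using x(2,3) by (auto simp: axis_nth_if)
    have "\<not> x $ i \<le> 3"
      using pack3[of x 0 i] assms x(1) b * True by fastforce
    then show ?thesis
      using that(1)[of x] x(1) b * True by auto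
  next
    case False
    then have b: "-1 \<le> x $ m" "x $ m \<le> 2" "x $ i = 2 \<or> x $ i = 3"
      using x(2,3) spec[OF x(4), of i] by (auto simp: axis_nth_if)
    have "x $ i \<noteq> 2"
      using pack2[of x 0 i m] assms x(1) b * by fastforce
    moreover have "\<not> x $ m \<le> 1"
    proof
      assume "x $ m \<le> 1"
      then have "\<bar>x $ l - 0 $ l\<bar> \<le> 1" if "l \<noteq> i" for l
        using that *[of l] b by (cases "l = m") auto
      then show False
        using pack3[of x 0 i] assms x(1) b(3) by auto
    qed
    ultimately show ?thesis
      using that(2)[of x m] False b * x(1) by auto
  qed
qed


text \<open>Reflection in coordinate \<open>k\<close> turns the cover of \<open>axis i 2\<close>
  into the cover of \<open>axis i 2 + axis k (-1)\<close>. In the second case the bend is along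
  \<open>k\<close> itself, hence its negative sign.\<close>

lemma beyond_face_reflected:
  assumes "0 \<in> T" and "k \<noteq> i"
  obtains y where "y \<in> T" "y $ i = 4" "-1 \<le> y $ k" "y $ k \<le> 0" "\<And>l. \<lbrakk>l \<noteq> i; l \<noteq> k\<rbrakk> \<Longrightarrow> 0 \<le> y $ l \<and> y $ l \<le> 1"
  | y where "y \<in> T" "y $ i = 3" "y $ k = -2" "\<And>l. \<lbrakk>l \<noteq> i; l \<noteq> k\<rbrakk> \<Longrightarrow> 0 \<le> y $ l \<and> y $ l \<le> 1"
  | y j where "y \<in> T" "j \<noteq> i" "j \<noteq> k" "y $ i = 3" "y $ j = 2" "-1 \<le> y $ k" "y $ k \<le> 0"
      "\<And>l. \<lbrakk>l \<noteq> i; l \<noteq> j; l \<noteq> k\<rbrakk> \<Longrightarrow> 0 \<le> y $ l \<and> y $ l \<le> 1"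
proof -
  interpret R: half_cross_tiling "{x. reflect k x \<in> T}"
    by (rule reflection)
  have "0 \<in> {x. reflect k x \<in> T}"
    using assms by simp
  then show ?thesis
  proof (cases rule: R.beyond_face[of i])
    case (1 x)
    with assms show ?thesis
      using that(1)[of "reflect k x"] 1(3)[of k] by auto
  next
    case (2 x j)
    show ?thesis
    proof (cases "j = k")
      case True
      with 2 assms show ?thesis
        using that(2)[of "reflect k x"] by auto
    next
      case False
      with 2 assms show ?thesis
        using that(3)[of "reflect k x" j] 2(5)[of k] by auto
    qed
  qed
qed

text \<open>If another coordinate \<open>k\<close> of \<open>x\<close> were 1, the point covering
  \<open>axis i 2 + axis k (-1)\<close> would be too close to \<open>x\<close> in each of its
  possible positions, yet differ from \<open>x\<close> at \<open>k\<close>.\<close>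

lemma straight_neighbour:
  assumes "0 \<in> T" "x \<in> T" "x $ i = 4" and others: "\<And>l. l \<noteq> i \<Longrightarrow> 0 \<le> x $ l \<and> x $ l \<le> 1"
  shows "x = axis i 4"
proof -
  have "x $ k = 0" if "k \<noteq> i" for k
  proof (rule ccontr)
    assume "x $ k \<noteq> 0"
    then have k: "x $ k = 1"
      using others[OF that] by auto
    from assms(1) that show False
    proof (cases rule: beyond_face_reflected)
      case (1 y)
      have "x = y"
        by (rule pack3[of _ _ k]) (use assms k 1 that in \<open>smt (verit)\<close>)+
      with k 1 show False by auto
    next
      case (2 y)
      have "x = y"
        by (rule pack3[of _ _ k]) (use assms k 2 that in \<open>smt (verit)\<close>)+
      with k 2 show False by auto
    next
      case (3 y j)
      have "x = y"
        by (rule pack2[of _ _ j k]) (use assms(2-4) k 3 that in \<open>smt (verit)\<close>)+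
      with k 3 show False by auto
    qed
  qed
  then show ?thesis
    using assms(3) by (auto simp: vec_eq_iff axis_nth_if)
qed

text \<open>If a further coordinate \<open>k\<close> of \<open>x\<close> were 1, the point
  \<open>axis i 1 + axis j 1 + axis k (-1)\<close> would be at distance 2 from the cubes of both 0
  and \<open>x\<close>. Neither covers it, and any other candidate \<open>y\<close> is too close to
  one of them.\<close>

lemma bent_neighbour:
  assumes "0 \<in> T" "x \<in> T" "i \<noteq> j" "x $ i = 3" "x $ j = 2"
    and others: "\<And>l. \<lbrakk>l \<noteq> i; l \<noteq> j\<rbrakk> \<Longrightarrow> 0 \<le> x $ l \<and> x $ l \<le> 1"
  shows "x = axis i 3 + axis j 2"
proof -
  have "x $ k = 0" if "k \<noteq> i" "k \<noteq> j" for k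
  proof (rule ccontr)
    assume "x $ k \<noteq> 0"
    then have k: "x $ k = 1"
      using others[OF that] by auto
    obtain y m where y: "y \<in> T"
      and m: "-2 \<le> (axis i 1 + axis j 1 + axis k (-1)) $ m - y $ m"
        "(axis i 1 + axis j 1 + axis k (-1)) $ m - y $ m \<le> 1"
      and l: "\<forall>l. l \<noteq> m \<longrightarrow> -1 \<le> (axis i 1 + axis j 1 + axis k (-1)) $ l - y $ l \<and>
        (axis i 1 + axis j 1 + axis k (-1)) $ l - y $ l \<le> 0"
      by (rule obtain_cover[of "axis i 1 + axis j 1 + axis k (-1)"])
    have yi: "m \<noteq> i \<Longrightarrow> y $ i = 1 \<or> y $ i = 2" and yj: "m \<noteq> j \<Longrightarrow> y $ j = 1 \<or> y $ j = 2"
      and yk: "m \<noteq> k \<Longrightarrow> y $ k = -1 \<or> y $ k = 0"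
      using spec[OF l, of i] spec[OF l, of j] spec[OF l, of k] that assms(3)
      by (auto simp: axis_nth_if)
    have yl: "0 \<le> y $ l \<and> y $ l \<le> 1" if "l \<noteq> i" "l \<noteq> j" "l \<noteq> k" "l \<noteq> m" for l
      using spec[OF l, of l] that by (auto simp: axis_nth_if)
    have "x \<noteq> y"
      using yi yk k assms(4) that(1) by (cases "m = k") auto
    have "y \<noteq> 0"
      using yi yj assms(3) by (cases "m = i") auto
    \<comment> \<open>The cases locate the coordinate \<open>m\<close> in which the chosen point may
      leave the cube of \<open>y\<close>.\<close>
    consider "m = i" | "m = j" | "m = k" | "m \<noteq> i" "m \<noteq> j" "m \<noteq> k" by blast
    then show False
    proof cases
      case 1
      then have b: "0 \<le> y $ i" "y $ i \<le> 3"
        using m that assms(3) by (auto simp: axis_nth_if)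
      show False
      proof (cases "y $ i = 0")
        case True
        have "y = 0"
          by (rule pack2[of _ _ j j]) (use assms(1-3) 1 True y yj yk yl that in \<open>smt (verit) zero_index\<close>)+
        with \<open>y \<noteq> 0\<close> show False ..
      next
        case False
        have "x = y"
          by (rule pack2[of _ _ i k])
            (use assms(2-5) 1 False b y k yj yk yl others that in \<open>smt (verit)\<close>)+
        with \<open>x \<noteq> y\<close> show False ..
      qed
    next
      case 2
      then have b: "0 \<le> y $ j" "y $ j \<le> 3"
        using m that assms(3) by (auto simp: axis_nth_if)
      show False
      proof (cases "y $ j = 0")
        case True
        have "y = 0"
          by (rule pack2[of _ _ i i]) (use assms(1-3) 2 True y yi yk yl that in \<open>smt (verit) zero_index\<close>)+
        with \<open>y \<noteq> 0\<close> show False ..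
      next
        case False
        have "x = y"
          by (rule pack2[of _ _ i k])
            (use assms(2-5) 2 False b y k yi yk yl others that in \<open>smt (verit)\<close>)+
        with \<open>x \<noteq> y\<close> show False ..
      qed
    next
      case 3
      then have b: "-2 \<le> y $ k" "y $ k \<le> 1"
        using m that assms(3) by (auto simp: axis_nth_if)
      show False
      proof (cases "y $ i = 1")
        case True
        have "y = 0"
          by (rule pack2[of _ _ j k])
            (use assms(1-3) 3 True b y yj yl that in \<open>smt (verit) zero_index\<close>)+
        with \<open>y \<noteq> 0\<close> show False ..
      next
        case False
        have "x = y"
          by (rule pack3[of _ _ k])
            (use assms(2-5) 3 False b y k yi yj yl others that in \<open>smt (verit)\<close>)+
        with \<open>x \<noteq> y\<close> show False ..
      qed
    next
      case 4
      then have b: "-1 \<le> y $ m" "y $ m \<le> 2"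
        using m that assms(3) by (auto simp: axis_nth_if)
      show False
      proof (cases "y $ i = 1")
        case True
        have "y = 0"
          by (rule pack2[of _ _ j m])
            (use assms(1-3) 4 True b y yj yk yl that in \<open>smt (verit) zero_index\<close>)+
        with \<open>y \<noteq> 0\<close> show False ..
      next
        case False
        have "x = y"
          by (rule pack2[of _ _ k m])
            (use assms(2-5) 4 False b y k yi yj yk yl others that in \<open>smt (verit)\<close>)+
        with \<open>x \<noteq> y\<close> show False ..
      qed
    qed
  qed
  then show ?thesis
    using assms(3,4,5) by (auto simp: vec_eq_iff axis_nth_if)
qed


text \<open>Reflection in the bend direction \<open>j\<close> fixes \<open>axis i 4\<close>, so the
  reflected tiling has a bent neighbour too. Its bend is not along another \<open>m\<close>, as
  \<open>axis i 3 + axis m 2\<close> is too close to \<open>axis i 3 + axis j 2\<close>; hence both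
  signs of the bend occur.\<close>

lemma forward:
  assumes "0 \<in> T"
  shows "axis i 4 \<in> T \<or> (\<exists>j. j \<noteq> i \<and> axis i 3 + axis j 2 \<in> T \<and> axis i 3 + axis j (-2) \<in> T)"
proof -
  have *: "axis i 4 \<in> T \<or> (\<exists>j. j \<noteq> i \<and> axis i 3 + axis j 2 \<in> T)"
    using assms
  proof (cases rule: beyond_face[of i])
    case (1 x)
    then show ?thesis
      using straight_neighbour[OF assms, of x i] by auto
  next
    case (2 x j)
    then have "x = axis i 3 + axis j 2"
      using bent_neighbour[OF assms, of x i j] by auto
    with 2 show ?thesis by auto
  qed
  show ?thesis
  proof (cases "axis i 4 \<in> T")
    case False
    then obtain j where j: "j \<noteq> i" "axis i 3 + axis j 2 \<in> T"
      using * by blast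
    interpret R: half_cross_tiling "{x. reflect j x \<in> T}"
      by (rule reflection)
    have "0 \<in> {x. reflect j x \<in> T}"
      using assms by simp
    then consider "axis i 3 + axis j 2 \<in> {x. reflect j x \<in> T}"
      | m where "m \<noteq> i" "m \<noteq> j" "axis i 3 + axis m 2 \<in> {x. reflect j x \<in> T}"
    proof (cases rule: R.beyond_face[of i])
      case (1 x)
      with False j show ?thesis
        using R.straight_neighbour[of x i] \<open>0 \<in> {x. reflect j x \<in> T}\<close> by (auto simp: reflect_axis)
    next
      case (2 x m)
      then have "x = axis i 3 + axis m 2"
        using R.bent_neighbour[of x i m] \<open>0 \<in> {x. reflect j x \<in> T}\<close> by auto
      with 2 that show ?thesis by (cases "m = j") auto
    qed
    then show ?thesis
    proof cases
      case 1
      with j show ?thesis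
        by (auto simp: reflect_add reflect_axis)
    next
      case (2 m)
      then have "axis i 3 + axis m 2 \<in> T"
        using j by (auto simp: reflect_add reflect_axis)
      then have "axis i 3 + axis m 2 = axis i 3 + axis j (2 :: int)"
        by (rule pack2[of _ _ j m]) (use j 2 in \<open>auto simp: axis_nth_if\<close>)
      with 2 show ?thesis
        by (simp add: axis_eq_axis)
    qed
  qed simp
qed

lemma forward_at:
  assumes "x \<in> T"
  shows "x + axis i 4 \<in> T \<or>
    (\<exists>j. j \<noteq> i \<and> x + axis i 3 + axis j 2 \<in> T \<and> x + axis i 3 + axis j (-2) \<in> T)"
  using half_cross_tiling.forward[OF translate, of x i] assms by (simp add: add.assoc)


section \<open>The gap between the cubes of 0 and \<open>axis i 4\<close>\<close>

text \<open>The point to be covered is \<open>axis i 2 + axis j 1\<close>. Packing against 0 and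
  \<open>axis i 4\<close> forces its exceptional coordinate to be \<open>j\<close> (first case) or a
  third direction \<open>k\<close> (second case), in extreme position.\<close>

lemma gap:
  assumes "0 \<in> T" "axis i 4 \<in> T" and "j \<noteq> i"
  obtains x where "x \<in> T" "x $ i = 2" "x $ j = 3" "\<And>l. \<lbrakk>l \<noteq> i; l \<noteq> j\<rbrakk> \<Longrightarrow> 0 \<le> x $ l \<and> x $ l \<le> 1"
  | x k where "x \<in> T" "k \<noteq> i" "k \<noteq> j" "x $ i = 2" "x $ j = 2" "x $ k = 2"
      "\<And>l. \<lbrakk>l \<noteq> i; l \<noteq> j; l \<noteq> k\<rbrakk> \<Longrightarrow> 0 \<le> x $ l \<and> x $ l \<le> 1"
proof -
  obtain x m where x: "x \<in> T"
    and m: "-2 \<le> (axis i 2 + axis j 1) $ m - x $ m"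
      "(axis i 2 + axis j 1) $ m - x $ m \<le> 1"
    and l: "\<forall>l. l \<noteq> m \<longrightarrow> -1 \<le> (axis i 2 + axis j 1) $ l - x $ l \<and>
      (axis i 2 + axis j 1) $ l - x $ l \<le> 0"
    by (rule obtain_cover[of "axis i 2 + axis j 1"])
  have xi: "m \<noteq> i \<Longrightarrow> x $ i = 2 \<or> x $ i = 3" and xj: "m \<noteq> j \<Longrightarrow> x $ j = 1 \<or> x $ j = 2"
    using spec[OF l, of i] spec[OF l, of j] assms(3) by (auto simp: axis_nth_if)
  have xl: "0 \<le> x $ l \<and> x $ l \<le> 1" if "l \<noteq> i" "l \<noteq> j" "l \<noteq> m" for l
    using spec[OF l, of l] that by (auto simp: axis_nth_if)
  have zero: "x = 0" if "\<bar>x $ p\<bar> \<le> 2" "\<bar>x $ q\<bar> \<le> 2" "\<forall>l. l \<noteq> p \<and> l \<noteq> q \<longrightarrow> \<bar>x $ l\<bar> \<le> 1" for p q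
    by (rule pack2[of _ _ p q]) (use x assms(1) that in auto)
  define four :: "int ^ 'n" where "four = axis i 4"
  have four: "four \<in> T" "four $ i = 4" "\<forall>l. l \<noteq> i \<longrightarrow> four $ l = 0"
    using assms(2) by (auto simp: four_def axis_nth_if)
  consider "m = i" | "m = j" | "m \<noteq> i" "m \<noteq> j" by blast
  then show ?thesis
  proof cases
    case 1
    then have b: "1 \<le> x $ i" "x $ i \<le> 4"
      using m assms(3) by (auto simp: axis_nth_if)
    show ?thesis
    proof (cases "x $ i = 1")
      case True
      have "x = 0"
        by (rule zero[of j j]) (use 1 True xj xl assms(3) in \<open>smt (verit)\<close>)+
      with True show ?thesis by simp
    next
      case False
      have "x = four"
        by (rule pack2[of _ _ i j]) (use 1 b False x four xj xl assms(3) in \<open>smt (verit)\<close>)+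
      with xj 1 assms(3) four show ?thesis by auto
    qed
  next
    case 2
    then have b: "0 \<le> x $ j" "x $ j \<le> 3"
      using m assms(3) by (auto simp: axis_nth_if)
    have ne: "x \<noteq> four"
      using xi 2 assms(3) four by auto
    have "x = four" if "x $ j \<noteq> 3"
      by (rule pack2[of _ _ i j]) (use that 2 b x four xi xl assms(3) in \<open>smt (verit)\<close>)+
    with ne have "x $ j = 3"
      by blast
    have "x = four" if "x $ i \<noteq> 2"
      by (rule pack3[of _ _ j]) (use that 2 b x four xi xl assms(3) in \<open>smt (verit)\<close>)+
    with ne have "x $ i = 2"
      by blast
    with \<open>x $ j = 3\<close> show ?thesis
      using that(1)[of x] x xl 2 by blast
  next
    case 3
    then have b: "-1 \<le> x $ m" "x $ m \<le> 2"
      using m by (auto simp: axis_nth_if)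
    have ne: "x \<noteq> four" "x \<noteq> 0"
      using xi 3 four by auto
    have "x = four" if "x $ i \<noteq> 2"
      by (rule pack2[of _ _ m j]) (use that 3 b x four xi xj xl assms(3) in \<open>smt (verit)\<close>)+
    with ne have "x $ i = 2"
      by blast
    have "x = 0" if "x $ j \<noteq> 2"
      by (rule zero[of m i]) (use that 3 b \<open>x $ i = 2\<close> xj xl assms(3) in \<open>smt (verit)\<close>)+
    with ne have "x $ j = 2"
      by blast
    have "x = 0" if "x $ m \<noteq> 2"
      by (rule zero[of i j]) (use that 3 b \<open>x $ i = 2\<close> xj xl assms(3) in \<open>smt (verit)\<close>)+
    with ne have "x $ m = 2"
      by blast
    with \<open>x $ i = 2\<close> \<open>x $ j = 2\<close> show ?thesis
      using that(2)[of x m] x xl 3 by blast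
  qed
qed

text \<open>Reflection in a coordinate \<open>k\<close> with \<open>x $ k = 1\<close> fixes 0 and
  \<open>axis i 4\<close>, so \<open>gap\<close> describes the cover of
  \<open>axis i 2 + axis j 1 + axis k (-1)\<close> as well. In every case that cover is too close to
  \<open>x\<close>.\<close>

lemma gap_straight:
  assumes "0 \<in> T" "axis i 4 \<in> T" "j \<noteq> i" and x: "x \<in> T" "x $ i = 2" "x $ j = 3"
    and others: "\<And>l. \<lbrakk>l \<noteq> i; l \<noteq> j\<rbrakk> \<Longrightarrow> 0 \<le> x $ l \<and> x $ l \<le> 1"
  shows "x = axis i 2 + axis j 3"
proof -
  have "x $ k = 0" if "k \<noteq> i" "k \<noteq> j" for k
  proof (rule ccontr)
    assume "x $ k \<noteq> 0"
    then have k: "x $ k = 1"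
      using others[OF that] by auto
    interpret R: half_cross_tiling "{x. reflect k x \<in> T}"
      by (rule reflection)
    have "0 \<in> {x. reflect k x \<in> T}" "axis i 4 \<in> {x. reflect k x \<in> T}"
      using assms that by (auto simp: reflect_axis)
    then show False
      using \<open>j \<noteq> i\<close>
    proof (cases rule: R.gap)
      case (1 z)
      define y where "y = reflect k z"
      have y: "y \<in> T" "y $ i = 2" "y $ j = 3" "-1 \<le> y $ k" "y $ k \<le> 0"
        "\<forall>l. l \<noteq> i \<and> l \<noteq> j \<and> l \<noteq> k \<longrightarrow> 0 \<le> y $ l \<and> y $ l \<le> 1"
        using 1 1(4)[of k] that by (auto simp: y_def)
      have "x = y"
        by (rule pack2[of _ _ k k]) (use x y k others that in \<open>smt (verit)\<close>)+
      with y k show False by simp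
    next
      case (2 z m)
      define y where "y = reflect k z"
      show False
      proof (cases "m = k")
        case True
        then have y: "y \<in> T" "y $ i = 2" "y $ j = 2" "y $ k = -2"
          "\<forall>l. l \<noteq> i \<and> l \<noteq> j \<and> l \<noteq> k \<longrightarrow> 0 \<le> y $ l \<and> y $ l \<le> 1"
          using 2 that by (auto simp: y_def)
        have "x = y"
          by (rule pack3[of _ _ k]) (use x y k others that in \<open>smt (verit)\<close>)+
        with y k show False by simp
      next
        case False
        then have y: "y \<in> T" "y $ i = 2" "y $ j = 2" "y $ m = 2" "-1 \<le> y $ k" "y $ k \<le> 0"
          "\<forall>l. l \<noteq> i \<and> l \<noteq> j \<and> l \<noteq> k \<and> l \<noteq> m \<longrightarrow> 0 \<le> y $ l \<and> y $ l \<le> 1"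
          using 2 2(7)[of k] that by (auto simp: y_def)
        have "x = y"
          by (rule pack2[of _ _ k m]) (use x y k 2(2,3) others that in \<open>smt (verit)\<close>)+
        with y k show False by simp
      qed
    qed
  qed
  then show ?thesis
    using assms by (auto simp: vec_eq_iff axis_nth_if)
qed

text \<open>If \<open>j\<close> and \<open>k\<close> differed,
  \<open>axis i 2 + axis j 1 + axis k 1\<close> would be at distance 2 from the cubes of
  \<open>u\<close> and \<open>v\<close> and 3 from that of \<open>w\<close>. So a fourth point
  \<open>y\<close> covers it, and each position of \<open>y\<close> is too close to one of these
  three.\<close>

lemma gap_unique:
  assumes "0 \<in> T" "axis i 4 \<in> T" "j \<noteq> i" "k \<noteq> i"
    and "axis i 2 + axis j 3 \<in> T" "axis i 2 + axis k 3 \<in> T"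
  shows "j = k"
proof (rule ccontr)
  assume "j \<noteq> k"
  note ne = assms(3,4) \<open>j \<noteq> k\<close>
  define u v w :: "int ^ 'n" where "u = axis i 2 + axis j 3" and "v = axis i 2 + axis k 3"
    and "w = axis i 4"
  have u: "u \<in> T" "u $ i = 2" "u $ j = 3" "\<forall>l. l \<noteq> i \<and> l \<noteq> j \<longrightarrow> u $ l = 0"
    and v: "v \<in> T" "v $ i = 2" "v $ k = 3" "\<forall>l. l \<noteq> i \<and> l \<noteq> k \<longrightarrow> v $ l = 0"
    and w: "w \<in> T" "w $ i = 4" "\<forall>l. l \<noteq> i \<longrightarrow> w $ l = 0"
    using assms ne by (auto simp: u_def v_def w_def axis_nth_if)
  obtain y m where y: "y \<in> T"
    and m: "-2 \<le> (axis i 2 + axis j 1 + axis k 1) $ m - y $ m"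
      "(axis i 2 + axis j 1 + axis k 1) $ m - y $ m \<le> 1"
    and l: "\<forall>l. l \<noteq> m \<longrightarrow> -1 \<le> (axis i 2 + axis j 1 + axis k 1) $ l - y $ l \<and>
      (axis i 2 + axis j 1 + axis k 1) $ l - y $ l \<le> 0"
    by (rule obtain_cover[of "axis i 2 + axis j 1 + axis k 1"])
  have yi: "m \<noteq> i \<Longrightarrow> y $ i = 2 \<or> y $ i = 3" and yj: "m \<noteq> j \<Longrightarrow> y $ j = 1 \<or> y $ j = 2"
    and yk: "m \<noteq> k \<Longrightarrow> y $ k = 1 \<or> y $ k = 2"
    using spec[OF l, of i] spec[OF l, of j] spec[OF l, of k] ne by (auto simp: axis_nth_if)
  have yl: "0 \<le> y $ l \<and> y $ l \<le> 1" if "l \<noteq> i" "l \<noteq> j" "l \<noteq> k" "l \<noteq> m" for l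
    using spec[OF l, of l] that by (auto simp: axis_nth_if)
  have "y \<noteq> u"
    using yj yk u ne by (cases "m = j") auto
  have "y \<noteq> v"
    using yj yk v ne by (cases "m = k") auto
  have "y \<noteq> w"
    using yj yk w ne by (cases "m = k") auto
  consider "m = i" | "m = j" | "m = k" | "m \<noteq> i" "m \<noteq> j" "m \<noteq> k" by blast
  then show False
  proof cases
    case 1
    then have b: "1 \<le> y $ i" "y $ i \<le> 4"
      using m ne by (auto simp: axis_nth_if)
    show False
    proof (cases "y $ i = 4")
      case True
      have "y = w"
        by (rule pack2[of _ _ j k]) (use 1 True y w yj yk yl ne in \<open>smt (verit)\<close>)+
      with \<open>y \<noteq> w\<close> show False ..
    next
      case False
      have "y = u"
        by (rule pack2[of _ _ j k]) (use 1 b False y u yj yk yl ne in \<open>smt (verit)\<close>)+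
      with \<open>y \<noteq> u\<close> show False ..
    qed
  next
    case 2
    then have b: "0 \<le> y $ j" "y $ j \<le> 3"
      using m ne by (auto simp: axis_nth_if)
    show False
    proof (cases "y $ k = 2")
      case True
      have "y = v"
        by (rule pack3[of _ _ j]) (use 2 b True y v yi yl ne in \<open>smt (verit)\<close>)+
      with \<open>y \<noteq> v\<close> show False ..
    next
      case False
      have "y = u"
        by (rule pack3[of _ _ j]) (use 2 b False y u yi yk yl ne in \<open>smt (verit)\<close>)+
      with \<open>y \<noteq> u\<close> show False ..
    qed
  next
    case 3
    then have b: "0 \<le> y $ k" "y $ k \<le> 3"
      using m ne by (auto simp: axis_nth_if)
    show False
    proof (cases "y $ j = 2")
      case True
      have "y = u"
        by (rule pack3[of _ _ k]) (use 3 b True y u yi yl ne in \<open>smt (verit)\<close>)+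
      with \<open>y \<noteq> u\<close> show False ..
    next
      case False
      have "y = v"
        by (rule pack3[of _ _ k]) (use 3 b False y v yi yj yl ne in \<open>smt (verit)\<close>)+
      with \<open>y \<noteq> v\<close> show False ..
    qed
  next
    case m': 4
    then have b: "-1 \<le> y $ m" "y $ m \<le> 2"
      using m by (auto simp: axis_nth_if)
    consider "y $ k = 1" | "y $ j = 1" | "y $ j = 2" "y $ k = 2"
      using m' yj yk by blast
    then show False
    proof cases
      case 1
      have "y = u"
        by (rule pack2[of _ _ j m]) (use m' b 1 y u yi yj yl ne in \<open>smt (verit)\<close>)+
      with \<open>y \<noteq> u\<close> show False ..
    next
      case 2
      have "y = v"
        by (rule pack2[of _ _ k m]) (use m' b 2 y v yi yk yl ne in \<open>smt (verit)\<close>)+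
      with \<open>y \<noteq> v\<close> show False ..
    next
      case 3
      have "y = u"
        by (rule pack2[of _ _ k m]) (use m' b 3 y u yi yl ne in \<open>smt (verit)\<close>)+
      with \<open>y \<noteq> u\<close> show False ..
    qed
  qed
qed

text \<open>Parity: if the first case of \<open>gap\<close> never occurs, the second matches each
  direction other than \<open>i\<close> with exactly one partner, and an odd number of directions is
  split into pairs.\<close>

lemma gap_exists:
  assumes "0 \<in> T" "axis i 4 \<in> T" and "even CARD('n)"
  shows "\<exists>j. j \<noteq> i \<and> axis i 2 + axis j 3 \<in> T"
proof (rule ccontr)
  assume none: "\<nexists>j. j \<noteq> i \<and> axis i 2 + axis j 3 \<in> T"
  \<comment> \<open>\<open>R j k\<close> holds when one point of \<open>T\<close>, placed as in the
    second case of \<open>gap\<close>, covers both \<open>axis i 2 + axis j 1\<close> and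
    \<open>axis i 2 + axis k 1\<close>.\<close>
  define R where "R j k \<longleftrightarrow> j \<noteq> i \<and> k \<noteq> i \<and> j \<noteq> k \<and> (\<exists>x\<in>T. x $ i = 2 \<and> x $ j = 2 \<and> x $ k = 2 \<and>
    (\<forall>l. l \<noteq> i \<and> l \<noteq> j \<and> l \<noteq> k \<longrightarrow> 0 \<le> x $ l \<and> x $ l \<le> 1))" for j k
  have ex: "\<exists>k. R j k" if "j \<noteq> i" for j
    using assms(1,2) that
  proof (cases rule: gap)
    case (1 x)
    with none that show ?thesis
      using gap_straight[OF assms(1,2) that, of x] by blast
  next
    case (2 x k)
    with that show ?thesis
      unfolding R_def by metis
  qed
  have sym: "R k j" if "R j k" for j k
    using that unfolding R_def by metis
  have uniq: "k = k'" if "R j k" "R j k'" for j k k'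
  proof (rule ccontr)
    assume "k \<noteq> k'"
    obtain x y where x: "x \<in> T" "x $ i = 2" "x $ j = 2" "x $ k = 2"
        "\<forall>l. l \<noteq> i \<and> l \<noteq> j \<and> l \<noteq> k \<longrightarrow> 0 \<le> x $ l \<and> x $ l \<le> 1"
      and y: "y \<in> T" "y $ i = 2" "y $ j = 2" "y $ k' = 2"
        "\<forall>l. l \<noteq> i \<and> l \<noteq> j \<and> l \<noteq> k' \<longrightarrow> 0 \<le> y $ l \<and> y $ l \<le> 1"
      and ne: "k \<noteq> i" "k \<noteq> j" "k' \<noteq> i" "k' \<noteq> j"
      using \<open>R j k\<close> \<open>R j k'\<close> unfolding R_def by metis
    have "x = y"
      by (rule pack2[of _ _ k k']) (use x y ne \<open>k \<noteq> k'\<close> in \<open>smt (verit)\<close>)+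
    with y(5) x(4) ne \<open>k \<noteq> k'\<close> show False
      by fastforce
  qed
  have "2 dvd card (\<Union>{{j, k} | j k. R j k})"
  proof (rule dvd_partition)
    show "\<forall>c\<in>{{j, k} |j k. R j k}. 2 dvd card c"
      by (auto simp: R_def)
    have "{j, k} = {j', k'}" if "R j k" "R j' k'" "l \<in> {j, k}" "l \<in> {j', k'}" for j k j' k' l
    proof -
      have "{j, k} = {l, m}" if "R j k" "R l m" "l \<in> {j, k}" for j k l m
        using that sym[OF that(1)] uniq by blast
      moreover have "\<exists>m. R l m"
        using that sym by blast
      ultimately show ?thesis
        using that by metis
    qed
    then show "\<forall>c1\<in>{{j, k} |j k. R j k}. \<forall>c2\<in>{{j, k} |j k. R j k}. c1 \<noteq> c2 \<longrightarrow> c1 \<inter> c2 = {}"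
      by (smt (verit, best) disjoint_iff mem_Collect_eq)
  qed simp
  moreover have "\<Union>{{j, k} | j k. R j k} = UNIV - {i}"
  proof (intro equalityI subsetI)
    fix j assume "j \<in> UNIV - {i}"
    then obtain k where "R j k"
      using ex by auto
    then show "j \<in> \<Union>{{j, k} | j k. R j k}"
      by blast
  qed (auto simp: R_def)
  moreover have "card (UNIV - {i}) + 1 = CARD('n)"
    using card_Suc_Diff1[of UNIV i] by simp
  ultimately show False
    using \<open>even CARD('n)\<close> by (metis even_plus_one_iff)
qed

text \<open>\<open>gap_exists\<close> in the tiling reflected in \<open>j\<close> yields a direction
  \<open>k\<close>. If \<open>k\<close> is not \<open>j\<close>, the reflection fixes
  \<open>axis i 2 + axis k 3\<close>, against \<open>gap_unique\<close>; so \<open>k = j\<close>,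
  and 3 becomes -3.\<close>

lemma gap_both:
  assumes "0 \<in> T" "axis i 4 \<in> T" "even CARD('n)" "j \<noteq> i" "axis i 2 + axis j 3 \<in> T"
  shows "axis i 2 + axis j (-3) \<in> T"
proof -
  interpret R: half_cross_tiling "{x. reflect j x \<in> T}"
    by (rule reflection)
  obtain k where k: "k \<noteq> i" "reflect j (axis i 2 + axis k 3) \<in> T"
    using R.gap_exists[of i] assms by (auto simp: reflect_axis)
  show ?thesis
  proof (cases "k = j")
    case True
    with k assms(4) show ?thesis
      by (simp add: reflect_add reflect_axis)
  next
    case False
    with k assms(4) have "axis i 2 + axis k 3 \<in> T"
      by (simp add: reflect_add reflect_axis)
    with gap_unique[OF assms(1,2,4) k(1)] assms(5) False show ?thesis
      by simp
  qed
qed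

lemma gap_both_down_at:
  assumes "x \<in> T" "x + axis i 4 \<in> T" "even CARD('n)" "j \<noteq> i" "x + axis i 2 + axis j 3 \<in> T"
  shows "x + axis i 2 + axis j (-3) \<in> T"
  using half_cross_tiling.gap_both[OF translate, of x i j] assms by (simp add: add.assoc)

lemma gap_both_up_at:
  assumes "x \<in> T" "x + axis i 4 \<in> T" "even CARD('n)" "j \<noteq> i" "x + axis i 2 + axis j (-3) \<in> T"
  shows "x + axis i 2 + axis j 3 \<in> T"
proof -
  interpret R: half_cross_tiling "{x. reflect j x \<in> T}"
    by (rule reflection)
  show ?thesis
    using R.gap_both_down_at[of "reflect j x" i j] assms by (simp add: reflect_add reflect_axis)
qed

section \<open>Steps along an axis and the period 12\<close>

text \<open>Moving from \<open>x\<close> in direction \<open>j\<close>, \<open>forward_at\<close>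
  has one possible outcome: \<open>x + axis j 4\<close> and bends along directions other than
  \<open>i\<close> are too close to the second given point \<open>y\<close>. The bend along
  \<open>i\<close> has both signs.\<close>

lemma hop:
  assumes "x \<in> T" "x + axis i (-2) + axis j 3 \<in> T" "i \<noteq> j"
  shows "x + axis i 2 + axis j 3 \<in> T"
proof -
  define y where "y = x + axis i (-2) + axis j 3"
  have far: False if "z \<in> T" "z $ i = x $ i" "\<bar>z $ m - y $ m\<bar> \<le> 2"
      "\<And>l. \<lbrakk>l \<noteq> i; l \<noteq> m\<rbrakk> \<Longrightarrow> \<bar>z $ l - y $ l\<bar> \<le> 1" for z m
  proof -
    have "z = y"
      by (rule pack2[of _ _ i m]) (use assms that in \<open>auto simp: y_def axis_nth_if\<close>)
    with that(2) assms(3) show False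
      by (simp add: y_def axis_nth_if)
  qed
  have "x + axis j 4 \<notin> T"
    using far[of "x + axis j 4" j] assms(3) by (auto simp: y_def axis_nth_if)
  then obtain m where m: "m \<noteq> j" "x + axis j 3 + axis m 2 \<in> T"
    using forward_at[OF assms(1), of j] by blast
  have "m = i"
  proof (rule ccontr)
    assume "m \<noteq> i"
    then show False
      using far[OF m(2), of m] m(1) assms(3) by (auto simp: y_def axis_nth_if)
  qed
  with m show ?thesis
    by (simp add: ac_simps)
qed

lemma hop_down:
  assumes "x \<in> T" "x + axis i (-2) + axis j (-3) \<in> T" "i \<noteq> j"
  shows "x + axis i 2 + axis j (-3) \<in> T"
proof -
  interpret R: half_cross_tiling "{x. reflect j x \<in> T}"
    by (rule reflection)
  show ?thesis
    using R.hop[of "reflect j x" i j] assms by (simp add: reflect_add reflect_axis)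
qed

text \<open>The two bent neighbours of \<open>x\<close> are four apart along \<open>j\<close>, and
  \<open>x\<close> lies in the gap between them. By \<open>gap_both_up_at\<close> its mirror image
  in that gap, \<open>x + axis i 6\<close>, is in \<open>T\<close> too.\<close>

lemma step_6:
  assumes "x \<in> T" "x + axis i 4 \<notin> T" "even CARD('n)"
  shows "x + axis i 6 \<in> T"
proof -
  obtain j where j: "j \<noteq> i" "x + axis i 3 + axis j 2 \<in> T" "x + axis i 3 + axis j (-2) \<in> T"
    using forward_at[OF assms(1), of i] assms(2) by blast
  define y where "y = x + axis i 3 + axis j (-2)"
  have eq: "y + axis j 4 = x + axis i 3 + axis j 2" "y + axis j 2 + axis i (-3) = x"
      "y + axis j 2 + axis i 3 = x + axis i 6"
    using j(1) by (auto simp: y_def vec_eq_iff axis_nth_if)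
  show ?thesis
    using gap_both_up_at[of y j i] unfolding eq using j assms by (simp add: y_def)
qed

text \<open>Two hops: seen from \<open>x + axis i 4\<close>, the gap point
  \<open>x + axis i 2 + axis j (-3)\<close> is mirrored to \<open>y\<close>; seen from
  \<open>y\<close>, the point \<open>x + axis i 4\<close> is mirrored to
  \<open>x + axis i 8\<close>.\<close>

lemma step_8:
  assumes "x \<in> T" "x + axis i 4 \<in> T" "even CARD('n)"
  shows "x + axis i 8 \<in> T"
proof -
  obtain j where j: "j \<noteq> i" "x + axis i 2 + axis j 3 \<in> T"
    using half_cross_tiling.gap_exists[OF translate, of x i] assms by (auto simp: add.assoc)
  then have j': "x + axis i 2 + axis j (-3) \<in> T"
    using gap_both_down_at assms by blast
  define y where "y = x + axis i 6 + axis j (-3)"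
  have eq: "x + axis i 4 + axis i (-2) + axis j (-3) = x + axis i 2 + axis j (-3)"
      "x + axis i 4 + axis i 2 + axis j (-3) = y"
    by (auto simp: vec_eq_iff axis_nth_if y_def)
  have "y \<in> T"
    using hop_down[OF assms(2), of i j] unfolding eq using j j' by simp
  moreover have eq': "y + axis i (-2) + axis j 3 = x + axis i 4" "y + axis i 2 + axis j 3 = x + axis i 8"
    by (auto simp: vec_eq_iff axis_nth_if y_def)
  ultimately show ?thesis
    using hop[of y i j] unfolding eq' using j assms(2) by simp
qed

lemma step_8_back:
  assumes "x \<in> T" "x + axis i (-4) \<in> T" "even CARD('n)"
  shows "x + axis i (-8) \<in> T"
proof -
  interpret R: half_cross_tiling "{x. reflect i x \<in> T}"
    by (rule reflection)
  show ?thesis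
    using R.step_8[of "reflect i x" i] assms by (simp add: reflect_add reflect_axis)
qed

text \<open>Steps of length 4 repeat by \<open>step_8\<close>, and three of them make 12. Steps of
  length 6 also repeat: a step of length 4 from \<open>x + axis i 6\<close> would, read backwards,
  continue to \<open>x + axis i 2\<close>, too close to \<open>x\<close>.\<close>

lemma step_12:
  assumes "x \<in> T" "even CARD('n)"
  shows "x + axis i 12 \<in> T"
proof (cases "x + axis i 4 \<in> T")
  case True
  have eq: "x + axis i 4 + axis i 4 = x + axis i 8" "x + axis i 4 + axis i 8 = x + axis i 12"
    by (auto simp: vec_eq_iff axis_nth_if)
  show ?thesis
    using step_8[of x i] step_8[of "x + axis i 4" i] unfolding eq using True assms by simp
next
  case False
  then have 6: "x + axis i 6 \<in> T"
    using step_6 assms by blast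
  have "x + axis i 10 \<notin> T"
  proof
    assume "x + axis i 10 \<in> T"
    have eq: "x + axis i 10 + axis i (-4) = x + axis i 6" "x + axis i 10 + axis i (-8) = x + axis i 2"
      by (auto simp: vec_eq_iff axis_nth_if)
    have "x + axis i 2 \<in> T"
      using step_8_back[of "x + axis i 10" i] unfolding eq using \<open>x + axis i 10 \<in> T\<close> 6 assms by simp
    then have "x + axis i 2 = x"
      using assms(1) by (rule pack2[of _ _ i i]) (auto simp: axis_nth_if)
    then show False
      by (simp add: axis_eq_0_iff)
  qed
  moreover have eq: "x + axis i 6 + axis i 4 = x + axis i 10" "x + axis i 6 + axis i 6 = x + axis i 12"
    by (auto simp: vec_eq_iff axis_nth_if)
  ultimately show ?thesis
    using step_6[of "x + axis i 6" i] unfolding eq using 6 assms by simp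
qed

end

section \<open>The dimension\<close>

text \<open>The packing conditions follow by exhibiting a common point \<open>z\<close> of the
  translates of \<open>upsilon\<close> by \<open>x\<close> and \<open>y\<close>.\<close>

lemma half_cross_tiling_of_integer_tiling:
  fixes T :: "(int ^ 'n) set"
  assumes "integer_tiling upsilon T"
  shows "half_cross_tiling T"
proof -
  have disj: "x = y" if "x \<in> T" "y \<in> T" "z - x \<in> upsilon" "z - y \<in> upsilon" for x y z
  proof (rule ccontr)
    assume "x \<noteq> y"
    then have "(+) x ` upsilon \<inter> (+) y ` upsilon = {}"
      using assms that unfolding integer_tiling_def disjoint_family_on_def by blast
    moreover have "z \<in> (+) x ` upsilon" "z \<in> (+) y ` upsilon"
      using that by (auto intro: image_eqI[of _ _ "z - x"] image_eqI[of _ _ "z - y"])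
    ultimately show False by blast
  qed
  show ?thesis
  proof
    fix z :: "int ^ 'n"
    obtain x u where "x \<in> T" "u \<in> upsilon" "z = x + u"
      using assms unfolding integer_tiling_def by blast
    then show "\<exists>x\<in>T. \<exists>m. -2 \<le> z $ m - x $ m \<and> z $ m - x $ m \<le> 1 \<and>
        (\<forall>l. l \<noteq> m \<longrightarrow> -1 \<le> z $ l - x $ l \<and> z $ l - x $ l \<le> 0)"
      by (intro bexI[of _ x]) (auto simp: mem_upsilon_iff)
  next
    fix x y i j
    assume mem: "x \<in> T" "y \<in> T" and ij: "\<bar>x $ i - y $ i\<bar> \<le> 2" "\<bar>x $ j - y $ j\<bar> \<le> 2"
      and l: "\<And>l. \<lbrakk>l \<noteq> i; l \<noteq> j\<rbrakk> \<Longrightarrow> \<bar>x $ l - y $ l\<bar> \<le> 1"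
    \<comment> \<open>At \<open>i\<close> the point stays in the range of the cube of
      \<open>y\<close> and may leave that of \<open>x\<close>; at \<open>j\<close> the roles are
      exchanged. If \<open>i = j\<close>, the first branch serves both.\<close>
    define z where "z = (\<chi> l. if l = i then (if x $ l < y $ l then y $ l - 1 else y $ l)
      else if l = j then (if y $ l < x $ l then x $ l - 1 else x $ l) else min (x $ l) (y $ l))"
    have "z - x \<in> upsilon"
      unfolding mem_upsilon_iff
      by (rule exI[of _ i]) (use ij l in \<open>fastforce simp: z_def min_def split: if_splits\<close>)
    moreover have "z - y \<in> upsilon"
      unfolding mem_upsilon_iff
      by (rule exI[of _ j]) (use ij l in \<open>fastforce simp: z_def min_def split: if_splits\<close>)
    ultimately show "x = y"
      using disj mem by blast
  next
    fix x y i
    assume mem: "x \<in> T" "y \<in> T" and i: "\<bar>x $ i - y $ i\<bar> \<le> 3"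
      and l: "\<And>l. l \<noteq> i \<Longrightarrow> \<bar>x $ l - y $ l\<bar> \<le> 1"
    \<comment> \<open>Both translates use their extra room at \<open>i\<close>: the ranges from -2
      to 1 about \<open>x $ i\<close> and \<open>y $ i\<close> share the smaller value plus
      1.\<close>
    define z where "z = (\<chi> l. if l = i then (if x $ l \<le> y $ l then x $ l + 1 else y $ l + 1)
      else min (x $ l) (y $ l))"
    have "z - x \<in> upsilon" "z - y \<in> upsilon"
      unfolding mem_upsilon_iff
      by (rule exI[of _ i], use i l in \<open>fastforce simp: z_def min_def split: if_splits\<close>)+
    then show "x = y"
      using disj mem by blast
  qed
qed

theorem theorem5:
  fixes T :: "(int ^ 'n) set"
  assumes "integer_tiling upsilon T"
    and "even CARD('n)"
  shows "\<exists>t::nat. t > 0 \<and> CARD('n) = 3 ^ t - 1"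
proof -
  interpret half_cross_tiling T
    using assms(1) by (rule half_cross_tiling_of_integer_tiling)
  have "(CARD('n) + 1) dvd card (upsilon :: (int ^ 'n) set)"
    by (rule CARD_Suc_dvd_card_upsilon)
  also have "card (upsilon :: (int ^ 'n) set) dvd 12 ^ CARD('n)"
    using card_dvd_of_periodic_tiling[OF assms(1), of 12] step_12 assms(2) by simp
  also have "(12 :: nat) ^ CARD('n) = 4 ^ CARD('n) * 3 ^ CARD('n)"
    by (simp flip: power_mult_distrib)
  finally have "(CARD('n) + 1) dvd 4 ^ CARD('n) * 3 ^ CARD('n)" .
  moreover have "coprime (CARD('n) + 1) (4 ^ CARD('n))"
  proof -
    have "coprime (CARD('n) + 1) (2 ^ 2)"
      unfolding coprime_power_right_iff using assms(2) by simp
    then show ?thesis by simp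
  qed
  ultimately have "(CARD('n) + 1) dvd 3 ^ CARD('n)"
    using coprime_dvd_mult_right_iff by blast
  then obtain t where "CARD('n) + 1 = 3 ^ t"
    using divides_primepow_nat[of 3] by auto
  \<comment> \<open>\<open>t = 0\<close> would give \<open>CARD('n) = 0\<close>, but types are
    nonempty.\<close>
  moreover from this have "t > 0"
    by (cases t) auto
  ultimately show ?thesis
    by (intro exI[of _ t]) simp
qed

end
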